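(* For all natural numbers $m\neq n$, the formula $\Box^m\overline p\vee\Diamond^n p$ (i.e. $\Diamond^m p\to\Diamond^n p$) is absolutely minimal among all $\mathsf L_\Diamond$-formulas defining the class of frames satisfying $(m,n)$-transfer, i.e. the frames $(W,R)$ with $\forall x\forall y\,(xR^my\to xR^ny)$.
   Context: Fix a countably infinite set of propositional variables $P$. $\mathsf L_\Diamond$ is the set of formulas in negation normal form built from literals $p,\overline p$ ($p\in P$), $\bot$ and $\top$ using $\vee,\wedge,\Diamond,\Box$; $\neg$ and $\to$ are abbreviations via De Morgan's rules. A frame is $(W,R)$ with $W$ nonempty and $R\subseteq W\times W$; $R^j$ is the $j$-fold composition of $R$ ($R^0$ the identity); $\Diamond^j,\Box^j$ denote $j$-fold iteration. A formula is valid on a frame if true at every point under every valuation (standard Kripke semantics, $\overline p$ being true iff $p$ is false). A formula $\varphi$ defines a class $\mathcal F$ of frames if for every frame $\mathcal A$, $\varphi$ is valid on $\mathcal A$ iff $\mathcal A\in\mathcal F$. The complexity measures considered are: the length (number of nodes of the syntax tree, leaves included); for each symbol among $\vee,\wedge,\Diamond,\Box,\bot,\top$, the number of its occurrences; the modal depth; and the number of distinct propositional variables. Given a set $\Gamma$ of formulas and $\varphi\in\Gamma$, $\varphi$ is absolutely minimal among $\Gamma$ if $\mu(\varphi)\leq\mu(\psi)$ for all $\psi\in\Gamma$ and every one of these measures $\mu$. *)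

theory Defs
  imports Main
begin

text \<open>Formulas in negation normal form over the variables \<open>0, 1, 2, \<dots>\<close>.
  \<open>NegVar p\<close> is the literal \<open>p\<close> overlined; it is a single leaf of the syntax tree.\<close>

datatype fm =
    Var nat
  | NegVar nat
  | Bot
  | Top
  | Or fm fm
  | And fm fm
  | Dia fm
  | Box fm

type_synonym 'w frame = "'w set \<times> ('w \<times> 'w) set"

definition is_frame :: "'w frame \<Rightarrow> bool" where
  "is_frame = (\<lambda>(W, R). W \<noteq> {} \<and> R \<subseteq> W \<times> W)"

primrec sat :: "'w frame \<Rightarrow> (nat \<Rightarrow> 'w set) \<Rightarrow> 'w \<Rightarrow> fm \<Rightarrow> bool" where
  "sat A V w (Var p) \<longleftrightarrow> w \<in> V p"
| "sat A V w (NegVar p) \<longleftrightarrow> w \<notin> V p"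
| "sat A V w Bot \<longleftrightarrow> False"
| "sat A V w Top \<longleftrightarrow> True"
| "sat A V w (Or \<phi> \<psi>) \<longleftrightarrow> sat A V w \<phi> \<or> sat A V w \<psi>"
| "sat A V w (And \<phi> \<psi>) \<longleftrightarrow> sat A V w \<phi> \<and> sat A V w \<psi>"
| "sat A V w (Dia \<phi>) \<longleftrightarrow> (\<exists>v. (w, v) \<in> snd A \<and> sat A V v \<phi>)"
| "sat A V w (Box \<phi>) \<longleftrightarrow> (\<forall>v. (w, v) \<in> snd A \<longrightarrow> sat A V v \<phi>)"

text \<open>Valuations may contain elements outside the set of worlds; these do not affect
  truth at worlds of a frame, since the accessibility relation stays inside it.\<close>

definition valid :: "'w frame \<Rightarrow> fm \<Rightarrow> bool" where
  "valid A \<phi> \<longleftrightarrow> (\<forall>V. \<forall>w\<in>fst A. sat A V w \<phi>)"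

text \<open>Frames live on subsets of the type \<open>'w\<close>, so definability is relative to \<open>'w\<close>:
  it ranges over the frames of cardinality at most that of \<open>'w\<close>, up to isomorphism.\<close>

definition defines_class :: "fm \<Rightarrow> 'w frame set \<Rightarrow> bool" where
  "defines_class \<phi> F \<longleftrightarrow> (\<forall>A. is_frame A \<longrightarrow> (valid A \<phi> \<longleftrightarrow> A \<in> F))"

definition transfer_frames :: "nat \<Rightarrow> nat \<Rightarrow> 'w frame set" where
  "transfer_frames m n =
    {(W, R). is_frame (W, R) \<and> (\<forall>x\<in>W. \<forall>y\<in>W. (x, y) \<in> R ^^ m \<longrightarrow> (x, y) \<in> R ^^ n)}"

primrec fm_length :: "fm \<Rightarrow> nat" where
  "fm_length (Var p) = 1"
| "fm_length (NegVar p) = 1"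
| "fm_length Bot = 1"
| "fm_length Top = 1"
| "fm_length (Or \<phi> \<psi>) = 1 + fm_length \<phi> + fm_length \<psi>"
| "fm_length (And \<phi> \<psi>) = 1 + fm_length \<phi> + fm_length \<psi>"
| "fm_length (Dia \<phi>) = 1 + fm_length \<phi>"
| "fm_length (Box \<phi>) = 1 + fm_length \<phi>"

datatype symb = OrS | AndS | DiaS | BoxS | BotS | TopS

primrec occs :: "symb \<Rightarrow> fm \<Rightarrow> nat" where
  "occs s (Var p) = 0"
| "occs s (NegVar p) = 0"
| "occs s Bot = of_bool (s = BotS)"
| "occs s Top = of_bool (s = TopS)"
| "occs s (Or \<phi> \<psi>) = of_bool (s = OrS) + occs s \<phi> + occs s \<psi>"
| "occs s (And \<phi> \<psi>) = of_bool (s = AndS) + occs s \<phi> + occs s \<psi>"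
| "occs s (Dia \<phi>) = of_bool (s = DiaS) + occs s \<phi>"
| "occs s (Box \<phi>) = of_bool (s = BoxS) + occs s \<phi>"

primrec modal_depth :: "fm \<Rightarrow> nat" where
  "modal_depth (Var p) = 0"
| "modal_depth (NegVar p) = 0"
| "modal_depth Bot = 0"
| "modal_depth Top = 0"
| "modal_depth (Or \<phi> \<psi>) = max (modal_depth \<phi>) (modal_depth \<psi>)"
| "modal_depth (And \<phi> \<psi>) = max (modal_depth \<phi>) (modal_depth \<psi>)"
| "modal_depth (Dia \<phi>) = 1 + modal_depth \<phi>"
| "modal_depth (Box \<phi>) = 1 + modal_depth \<phi>"

primrec vars :: "fm \<Rightarrow> nat set" where
  "vars (Var p) = {p}"
| "vars (NegVar p) = {p}"
| "vars Bot = {}"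
| "vars Top = {}"
| "vars (Or \<phi> \<psi>) = vars \<phi> \<union> vars \<psi>"
| "vars (And \<phi> \<psi>) = vars \<phi> \<union> vars \<psi>"
| "vars (Dia \<phi>) = vars \<phi>"
| "vars (Box \<phi>) = vars \<phi>"

definition complexity_measures :: "(fm \<Rightarrow> nat) set" where
  "complexity_measures = {fm_length, modal_depth, \<lambda>\<phi>. card (vars \<phi>)} \<union> range occs"

definition absolutely_minimal :: "fm set \<Rightarrow> fm \<Rightarrow> bool" where
  "absolutely_minimal \<Gamma> \<phi> \<longleftrightarrow>
    \<phi> \<in> \<Gamma> \<and> (\<forall>\<psi>\<in>\<Gamma>. \<forall>\<mu>\<in>complexity_measures. \<mu> \<phi> \<le> \<mu> \<psi>)"

end

theory Submission
  imports Defs "HOL-Library.Countable"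
begin

text \<open>Each lower bound comes from a frame violating transfer on which a formula lacking the
  resource in question would be valid as soon as it is valid on the frames with transfer.

  \<^item> Disjunction and variables: on serial frames, a formula without \<open>\<or>\<close> is constantly true or
    is refuted by an empty or by a full valuation, and a formula without variables is constant.
    So neither separates the reflexive point from the infinite path.

  \<^item> Boxes and depth \<open>m\<close>: on the path \<open>0 \<rightarrow> 1 \<rightarrow> \<dots> \<rightarrow> m\<close>, an occurrence of \<open>\<box>\<close> under \<open>d\<close> modalities
    is only evaluated at the point \<open>d\<close> steps from the start. If no \<open>\<box>\<close> occurs at depth \<open>c < m\<close>,
    the edge \<open>c \<rightarrow> c + 1\<close> can be deleted without destroying a refutation at \<open>0\<close>, and
    deleting \<open>0 \<rightarrow> 1\<close> preserves refutations elsewhere; but either way no two points are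
    related by \<open>R\<^sup>m\<close> any more. So there is a \<open>\<box>\<close> at every depth below \<open>m\<close>.

  \<^item> Diamonds and depth \<open>n\<close>: if at most \<open>n - 1\<close> occurrences of \<open>\<diamond>\<close> are nested, equip the points of
    the infinite path with a budget \<open>j < n\<close> which an edge may lower by one; points with budget \<open>0\<close>
    see everything. A refutation on the path lifts to points whose budget is at least the
    nesting of \<open>\<diamond>\<close>, while \<open>R\<^sup>n\<close> is total on the new frame.\<close>


subsection \<open>Transport of frames\<close>

lemma defines_classD: "defines_class \<phi> F \<Longrightarrow> is_frame A \<Longrightarrow> valid A \<phi> \<longleftrightarrow> A \<in> F"
  by (simp only: defines_class_def)

lemma relpow_image_iff:
  assumes "inj f"
  shows "(f a, f b) \<in> (map_prod f f ` R) ^^ k \<longleftrightarrow> (a, b) \<in> R ^^ k"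
proof (induction k arbitrary: b)
  case 0
  show ?case using assms by (simp add: inj_eq)
next
  case (Suc k)
  have edge: "(u, f b) \<in> map_prod f f ` R \<longleftrightarrow> (\<exists>c. u = f c \<and> (c, b) \<in> R)" for u
    using assms by (auto simp: inj_eq)
  have "(f a, f b) \<in> (map_prod f f ` R) ^^ Suc k
      \<longleftrightarrow> (\<exists>c. (f a, f c) \<in> (map_prod f f ` R) ^^ k \<and> (c, b) \<in> R)"
    using edge by (auto simp: relcomp_unfold)
  then show ?case using Suc by (auto simp: relcomp_unfold)
qed

lemma sat_image_iff:
  assumes "inj f"
  shows "sat (f ` W, map_prod f f ` R) V (f w) \<phi> \<longleftrightarrow> sat (W, R) (\<lambda>p. f -` V p) w \<phi>"
proof (induction \<phi> arbitrary: w)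
  case (Dia \<phi>)
  have "(f w, v) \<in> map_prod f f ` R \<longleftrightarrow> (\<exists>u. v = f u \<and> (w, u) \<in> R)" for v
    using assms by (auto simp: inj_eq)
  then show ?case using Dia by auto
next
  case (Box \<phi>)
  have "(f w, v) \<in> map_prod f f ` R \<longleftrightarrow> (\<exists>u. v = f u \<and> (w, u) \<in> R)" for v
    using assms by (auto simp: inj_eq)
  then show ?case using Box by auto
qed auto

lemma valid_image_iff:
  assumes "inj f"
  shows "valid (f ` W, map_prod f f ` R) \<phi> \<longleftrightarrow> valid (W, R) \<phi>"
proof
  assume *: "valid (f ` W, map_prod f f ` R) \<phi>"
  show "valid (W, R) \<phi>"
    unfolding valid_def
  proof (intro allI ballI)
    fix V w assume "w \<in> fst (W, R)"
    then have "sat (f ` W, map_prod f f ` R) (\<lambda>p. f ` V p) (f w) \<phi>"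
      using * by (simp add: valid_def)
    then show "sat (W, R) V w \<phi>"
      by (simp add: sat_image_iff[OF assms] inj_vimage_image_eq[OF assms])
  qed
qed (auto simp: valid_def sat_image_iff[OF assms])

lemma transfer_frames_image_iff:
  assumes "inj f" "is_frame (W, R)"
  shows "(f ` W, map_prod f f ` R) \<in> transfer_frames m n \<longleftrightarrow> (W, R) \<in> transfer_frames m n"
proof -
  have "is_frame (f ` W, map_prod f f ` R)"
    using assms(2) by (auto simp: is_frame_def)
  then show ?thesis
    using assms(2) by (simp add: transfer_frames_def relpow_image_iff[OF assms(1)])
qed

text \<open>A countable frame has an isomorphic copy inside any infinite type, and validity and
  transfer survive the copying. So the counterexample frames may live on naturals and pairs of
  naturals, whatever \<open>'w\<close> is.\<close>

lemma defines_transfer_countable: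
  assumes inf: "infinite (UNIV :: 'w set)"
    and def: "defines_class \<psi> (transfer_frames m n :: 'w frame set)"
  shows "defines_class \<psi> (transfer_frames m n :: 'a::countable frame set)"
proof -
  obtain g :: "nat \<Rightarrow> 'w" where "inj g"
    using infinite_countable_subset[OF inf] by blast
  define f where "f = (g \<circ> to_nat :: 'a \<Rightarrow> 'w)"
  have f: "inj f"
    unfolding f_def using \<open>inj g\<close> by (intro inj_compose inj_to_nat)
  show ?thesis
    unfolding defines_class_def
  proof (intro allI impI)
    fix A :: "'a frame" assume A: "is_frame A"
    obtain W R where [simp]: "A = (W, R)" by fastforce
    have "is_frame (f ` W, map_prod f f ` R)"
      using A by (auto simp: is_frame_def)
    then show "valid A \<psi> \<longleftrightarrow> A \<in> transfer_frames m n"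
      using defines_classD[OF def] A valid_image_iff[OF f, of W R \<psi>]
        transfer_frames_image_iff[OF f, of W R m n]
      by simp
  qed
qed


subsection \<open>The transfer formula\<close>

lemma sat_Dia_pow: "sat A V w ((Dia ^^ k) \<phi>) \<longleftrightarrow> (\<exists>v. (w, v) \<in> snd A ^^ k \<and> sat A V v \<phi>)"
proof (induction k arbitrary: w)
  case (Suc k)
  then show ?case by (auto simp: relpow_commute relcomp_unfold simp del: relpow.simps(2)
        intro: relpow_Suc_I2 elim!: relpow_Suc_E2)
qed simp

lemma sat_Box_pow: "sat A V w ((Box ^^ k) \<phi>) \<longleftrightarrow> (\<forall>v. (w, v) \<in> snd A ^^ k \<longrightarrow> sat A V v \<phi>)"
proof (induction k arbitrary: w)
  case (Suc k)
  then show ?case by (auto simp del: relpow.simps(2) intro: relpow_Suc_I2 elim!: relpow_Suc_E2)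
qed simp

lemma relpow_in_carrier:
  assumes "(x, y) \<in> R ^^ k" "R \<subseteq> W \<times> W" "x \<in> W"
  shows "y \<in> W"
  using assms by (induction k arbitrary: y) auto

lemma transfer_formula_defines:
  "defines_class (Or ((Box ^^ m) (NegVar p)) ((Dia ^^ n) (Var p))) (transfer_frames m n)"
  unfolding defines_class_def
proof (intro allI impI)
  fix A :: "'a frame" assume A: "is_frame A"
  obtain W R where WR: "A = (W, R)" by fastforce
  show "valid A (Or ((Box ^^ m) (NegVar p)) ((Dia ^^ n) (Var p))) \<longleftrightarrow> A \<in> transfer_frames m n"
    (is "valid A ?\<phi> \<longleftrightarrow> _")
  proof
    assume v: "valid A ?\<phi>"
    have "(x, y) \<in> R ^^ n" if "x \<in> W" "(x, y) \<in> R ^^ m" for x y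
    proof -
      \<comment> \<open>Minimal valuation: with \<open>p\<close> true at \<open>y\<close> alone, the
        box disjunct fails and a diamond witness can only be \<open>y\<close>.\<close>
      have "sat A (\<lambda>_. {y}) x ?\<phi>" using v that by (simp add: valid_def WR)
      then show ?thesis using that by (auto simp: sat_Dia_pow sat_Box_pow WR)
    qed
    then show "A \<in> transfer_frames m n" using A by (simp add: transfer_frames_def WR)
  next
    assume "A \<in> transfer_frames m n"
    moreover have "R \<subseteq> W \<times> W" using A by (simp add: WR is_frame_def)
    ultimately show "valid A ?\<phi>"
      using relpow_in_carrier[of _ _ m R W]
      by (fastforce simp: valid_def WR transfer_frames_def sat_Dia_pow sat_Box_pow)
  qed
qed


subsection \<open>Paths and serial frames\<close>

text \<open>All naturals stay points, so truncating the path or cutting an edge is a mere change of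
  \<open>E\<close>.\<close>

definition path :: "nat set \<Rightarrow> nat frame" where
  "path E = (UNIV, {(i, Suc i) | i. i \<in> E})"

lemma is_frame_path [simp]: "is_frame (path E)"
  by (simp add: is_frame_def path_def)

lemma in_path [simp]: "(x, y) \<in> snd (path E) \<longleftrightarrow> x \<in> E \<and> y = Suc x"
  by (auto simp: path_def)

lemma relpow_path:
  "(x, y) \<in> snd (path E) ^^ k \<longleftrightarrow> y = x + k \<and> (\<forall>i<k. x + i \<in> E)"
  by (induction k arbitrary: y) (auto simp: relcomp_unfold less_Suc_eq)

lemma path_transfer_iff:
  "path E \<in> transfer_frames m n
    \<longleftrightarrow> (\<forall>x y. (x, y) \<in> snd (path E) ^^ m \<longrightarrow> (x, y) \<in> snd (path E) ^^ n)"
  using is_frame_path[of E] by (simp add: transfer_frames_def path_def)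

lemma path_not_transfer:
  assumes "m \<noteq> n" "{..<m} \<subseteq> E"
  shows "path E \<notin> transfer_frames m n"
proof -
  have "(0, m) \<in> snd (path E) ^^ m" "(0, m) \<notin> snd (path E) ^^ n"
    using assms by (auto simp: relpow_path)
  then show ?thesis unfolding path_transfer_iff by blast
qed

definition loop :: "nat frame" where
  "loop = ({0}, {(0, 0)})"

lemma loop_transfer: "loop \<in> transfer_frames m n"
proof -
  have "(0, 0) \<in> {(0 :: nat, 0 :: nat)} ^^ k" for k
    by (induction k) auto
  then show ?thesis by (simp add: loop_def transfer_frames_def is_frame_def)
qed

definition serial :: "'w frame \<Rightarrow> bool" where
  "serial A \<longleftrightarrow> (\<forall>w\<in>fst A. \<exists>v\<in>fst A. (w, v) \<in> snd A)"

lemma is_frame_edge: "is_frame A \<Longrightarrow> (w, v) \<in> snd A \<Longrightarrow> v \<in> fst A"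
  by (auto simp: is_frame_def)

lemma serial_path [simp]: "serial (path UNIV)"
  by (auto simp: serial_def path_def)

text \<open>Seriality makes both modalities act as the identity on constant truth values.\<close>

lemma closed_serial_iff:
  assumes frames: "is_frame A" "serial A" "is_frame B" "serial B"
    and "w \<in> fst A" "v \<in> fst B" "vars \<phi> = {}"
  shows "sat A U w \<phi> \<longleftrightarrow> sat B V v \<phi>"
  using assms(5-)
proof (induction \<phi> arbitrary: w v)
  case (Dia \<phi>)
  have "\<exists>w'\<in>fst A. (w, w') \<in> snd A" "\<exists>v'\<in>fst B. (v, v') \<in> snd B"
    using frames Dia.prems by (auto simp: serial_def)
  then show ?case
    using Dia is_frame_edge[OF frames(1)] is_frame_edge[OF frames(3)] by simp blast
next
  case (Box \<phi>)
  have "\<exists>w'\<in>fst A. (w, w') \<in> snd A" "\<exists>v'\<in>fst B. (v, v') \<in> snd B"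
    using frames Box.prems by (auto simp: serial_def)
  then show ?case
    using Box is_frame_edge[OF frames(1)] is_frame_edge[OF frames(3)] by simp blast
qed auto

text \<open>Each literal fails under one of the two valuations, and a true conjunction has true
  parts. \<open>w\<close> and \<open>v\<close> are independent because the diamond witnesses may
  differ between the valuations; for boxes, seriality supplies successors.\<close>

lemma disjunction_free_serial:
  assumes frame: "is_frame A" "serial A"
    and "occs OrS \<phi> = 0" "w \<in> fst A" "v \<in> fst A"
    and "sat A (\<lambda>_. {}) w \<phi>" "sat A (\<lambda>_. UNIV) v \<phi>"
  shows "vars \<phi> = {}"
  using assms(3-)
proof (induction \<phi> arbitrary: w v)
  case (Dia \<phi>)
  then show ?case using is_frame_edge[OF frame(1)] by simp blast
next
  case (Box \<phi>)
  have "\<exists>w'\<in>fst A. (w, w') \<in> snd A" "\<exists>v'\<in>fst A. (v, v') \<in> snd A"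
    using frame Box.prems by (auto simp: serial_def)
  then show ?case using Box by simp blast
qed auto

lemma vars_nonempty:
  assumes "defines_class \<psi> (transfer_frames m n :: nat frame set)" "m \<noteq> n"
  shows "vars \<psi> \<noteq> {}"
proof
  assume closed: "vars \<psi> = {}"
  have frames: "is_frame loop" "serial loop"
    by (auto simp: loop_def is_frame_def serial_def)
  have "valid loop \<psi>"
    using defines_classD[OF assms(1) frames(1)] loop_transfer by blast
  then have "sat loop V 0 \<psi>" for V
    by (simp add: valid_def loop_def)
  then have "valid (path UNIV) \<psi>"
    using closed_serial_iff[OF frames is_frame_path serial_path _ _ closed, of 0]
    by (simp add: valid_def loop_def)
  then show False
    using assms(2) path_not_transfer[of m n UNIV] by (simp add: defines_classD[OF assms(1)])
qed

lemma disjunction_needed: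
  assumes "defines_class \<psi> (transfer_frames m n :: nat frame set)" "m \<noteq> n"
  shows "occs OrS \<psi> > 0"
proof (rule ccontr)
  assume "\<not> occs OrS \<psi> > 0"
  moreover have frames: "is_frame loop" "serial loop"
    by (auto simp: loop_def is_frame_def serial_def)
  moreover have "valid loop \<psi>"
    using defines_classD[OF assms(1) frames(1)] loop_transfer by blast
  then have "sat loop V 0 \<psi>" for V
    by (simp add: valid_def loop_def)
  ultimately have "vars \<psi> = {}"
    using disjunction_free_serial[of loop \<psi> 0 0] by (simp add: loop_def)
  then show False using vars_nonempty assms by blast
qed


subsection \<open>Boxes\<close>

primrec box_depths :: "fm \<Rightarrow> nat set" where
  "box_depths (Var p) = {}"
| "box_depths (NegVar p) = {}"
| "box_depths Bot = {}"
| "box_depths Top = {}"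
| "box_depths (Or \<phi> \<psi>) = box_depths \<phi> \<union> box_depths \<psi>"
| "box_depths (And \<phi> \<psi>) = box_depths \<phi> \<union> box_depths \<psi>"
| "box_depths (Dia \<phi>) = Suc ` box_depths \<phi>"
| "box_depths (Box \<phi>) = insert 0 (Suc ` box_depths \<phi>)"

lemma finite_box_depths: "finite (box_depths \<phi>)"
  by (induction \<phi>) auto

lemma card_box_depths: "card (box_depths \<phi>) \<le> occs BoxS \<phi>"
proof (induction \<phi>)
  case (Or \<phi> \<psi>)
  then show ?case using card_Un_le[of "box_depths \<phi>" "box_depths \<psi>"] by simp
next
  case (And \<phi> \<psi>)
  then show ?case using card_Un_le[of "box_depths \<phi>" "box_depths \<psi>"] by simp
qed (auto simp: card_image finite_box_depths card_insert_if)

lemma box_depths_less: "d \<in> box_depths \<phi> \<Longrightarrow> d < modal_depth \<phi>"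
  by (induction \<phi> arbitrary: d) (auto simp: less_max_iff_disj)

text \<open>Restoring an edge keeps all diamond witnesses. A box could lose truth only at
  \<open>c\<close>, the one point that may gain a successor, and no box is evaluated there.\<close>

lemma sat_path_delete_edge:
  assumes "sat (path (E - {c})) V w \<phi>" "\<forall>d\<in>box_depths \<phi>. w + d \<noteq> c"
  shows "sat (path E) V w \<phi>"
  using assms
proof (induction \<phi> arbitrary: w)
  case (Dia \<phi>)
  then show ?case by (auto simp: image_iff)
next
  case (Box \<phi>)
  then show ?case by (auto simp: image_iff)
qed auto

lemma box_at_every_depth:
  assumes "defines_class \<psi> (transfer_frames m n :: nat frame set)" "m \<noteq> n"
  shows "{..<m} \<subseteq> box_depths \<psi>"
proof
  fix c assume "c \<in> {..<m}"
  show "c \<in> box_depths \<psi>"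
  proof (rule ccontr)
    assume c: "c \<notin> box_depths \<psi>"
    have "valid (path ({..<m} - {b})) \<psi>" if "b < m" for b
    proof -
      have "(x, y) \<notin> snd (path ({..<m} - {b})) ^^ m" for x y
      proof
        assume "(x, y) \<in> snd (path ({..<m} - {b})) ^^ m"
        then have *: "x + i < m \<and> x + i \<noteq> b" if "i < m" for i
          using that by (auto simp: relpow_path)
        \<comment> \<open>A walk of length \<open>m\<close> needs all edges below \<open>m\<close>,
          so it starts at 0 and meets the missing one at step \<open>b\<close>.\<close>
        have "x = 0" using *[of "m - 1"] \<open>b < m\<close> by auto
        then show False using *[of b] \<open>b < m\<close> by auto
      qed
      then show ?thesis by (simp add: defines_classD[OF assms(1)] path_transfer_iff)
    qed
    then have sat: "sat (path ({..<m} - {b})) V w \<psi>" if "b < m" for b V w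
      using that by (simp add: valid_def path_def)
    have "sat (path {..<m}) V w \<psi>" for V w
    proof (cases w)
      case 0
      then show ?thesis
        using sat_path_delete_edge[OF sat[of c], of 0] c \<open>c \<in> {..<m}\<close> by (metis add_0 lessThan_iff)
    next
      case (Suc w')
      \<comment> \<open>From a point beyond 0, evaluation never returns to the edge leaving 0,
        whatever the box depths.\<close>
      then show ?thesis
        using sat_path_delete_edge[OF sat[of 0]] \<open>c \<in> {..<m}\<close> by auto
    qed
    then have "valid (path {..<m}) \<psi>" by (simp add: valid_def)
    then show False
      using assms(2) path_not_transfer[of m n "{..<m}"] by (simp add: defines_classD[OF assms(1)])
  qed
qed


subsection \<open>Diamonds\<close>

text \<open>Nesting bounds the budget spent, and it lies below both the number of diamonds and the
  modal depth, so one bound serves both measures.\<close>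

primrec dia_depth :: "fm \<Rightarrow> nat" where
  "dia_depth (Var p) = 0"
| "dia_depth (NegVar p) = 0"
| "dia_depth Bot = 0"
| "dia_depth Top = 0"
| "dia_depth (Or \<phi> \<psi>) = max (dia_depth \<phi>) (dia_depth \<psi>)"
| "dia_depth (And \<phi> \<psi>) = max (dia_depth \<phi>) (dia_depth \<psi>)"
| "dia_depth (Dia \<phi>) = 1 + dia_depth \<phi>"
| "dia_depth (Box \<phi>) = dia_depth \<phi>"

lemma dia_depth_le_occs: "dia_depth \<phi> \<le> occs DiaS \<phi>"
  by (induction \<phi>) auto

lemma dia_depth_le_modal_depth: "dia_depth \<phi> \<le> modal_depth \<phi>"
  by (induction \<phi>) auto

definition budget_frame :: "nat \<Rightarrow> (nat \<times> nat) frame" where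
  "budget_frame n =
    (UNIV \<times> {..<n},
     {((x, j), (y, i)) | x j y i. j < n \<and> i < n \<and> (j = 0 \<or> y = Suc x \<and> j \<le> Suc i)})"

lemma in_budget_frame [simp]:
  "((x, j), (y, i)) \<in> snd (budget_frame n)
    \<longleftrightarrow> j < n \<and> i < n \<and> (j = 0 \<or> y = Suc x \<and> j \<le> Suc i)"
  by (simp add: budget_frame_def)

lemma is_frame_budget_frame: "n > 0 \<Longrightarrow> is_frame (budget_frame n)"
  by (auto simp: budget_frame_def is_frame_def)

text \<open>Run the budget down to 0, then jump to the target in the last step.\<close>

lemma relpow_budget_frame:
  assumes "j \<le> k" "j < n" "i < n"
  shows "((x, j), (y, i)) \<in> snd (budget_frame n) ^^ Suc k"
  using assms(1,2)
proof (induction k arbitrary: x j)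
  case 0
  then show ?case using assms(3) by simp
next
  case (Suc k)
  \<comment> \<open>Truncated subtraction lets a walk at budget 0 stay at that budget, which pads it
    to the exact length.\<close>
  have "((x, j), (Suc x, j - 1)) \<in> snd (budget_frame n)"
    using Suc.prems by auto
  moreover have "((Suc x, j - 1), (y, i)) \<in> snd (budget_frame n) ^^ Suc k"
    using Suc by simp
  ultimately show ?case by (rule relpow_Suc_I2)
qed

lemma budget_frame_transfer:
  assumes "n > 0"
  shows "budget_frame n \<in> transfer_frames m n"
proof -
  obtain k where "n = Suc k" using assms gr0_implies_Suc by blast
  then have "((x, j), (y, i)) \<in> snd (budget_frame n) ^^ n" if "j < n" "i < n" for x j y i
    using that relpow_budget_frame[of j k n i x y] by simp
  then show ?thesis
    using is_frame_budget_frame[OF assms]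
    by (auto simp: transfer_frames_def budget_frame_def)
qed

text \<open>Below a diamond the budget is positive, so the witness lies over the next point of the
  path and has lost at most one unit. A box is tested at the successor of equal budget.\<close>

lemma sat_budget_frame:
  assumes "dia_depth \<phi> \<le> j" "j < n" "sat (budget_frame n) (\<lambda>p. V p \<times> UNIV) (x, j) \<phi>"
  shows "sat (path UNIV) V x \<phi>"
  using assms
proof (induction \<phi> arbitrary: x j)
  case (Dia \<phi>)
  then obtain y i where "((x, j), (y, i)) \<in> snd (budget_frame n)"
    "sat (budget_frame n) (\<lambda>p. V p \<times> UNIV) (y, i) \<phi>" by auto
  then show ?case using Dia.IH[of i y] Dia.prems(1) by auto
next
  case (Box \<phi>)
  then have "sat (budget_frame n) (\<lambda>p. V p \<times> UNIV) (Suc x, j) \<phi>" by simp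
  then show ?case using Box by auto
qed auto

lemma dia_depth_ge:
  assumes "defines_class \<psi> (transfer_frames m n :: nat frame set)"
    and "defines_class \<psi> (transfer_frames m n :: (nat \<times> nat) frame set)" "m \<noteq> n"
  shows "n \<le> dia_depth \<psi>"
proof (rule ccontr)
  assume less: "\<not> n \<le> dia_depth \<psi>"
  \<comment> \<open>In particular \<open>n\<close> is positive, so this frame has points.\<close>
  then have "valid (budget_frame n) \<psi>"
    using is_frame_budget_frame[of n] budget_frame_transfer[of n m]
    by (simp add: defines_classD[OF assms(2)])
  then have "sat (budget_frame n) V (x, dia_depth \<psi>) \<psi>" for V x
    using less by (simp add: valid_def budget_frame_def)
  then have "valid (path UNIV) \<psi>"
    using sat_budget_frame[of \<psi> "dia_depth \<psi>" n] less by (simp add: valid_def)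
  then show False
    using assms(3) path_not_transfer[of m n UNIV] by (simp add: defines_classD[OF assms(1)])
qed


subsection \<open>Minimality\<close>

text \<open>A tree has one leaf more than binary nodes, so each disjunction accounts for two nodes
  and one leaf is left over.\<close>

lemma fm_length_ge: "1 + 2 * occs OrS \<phi> + occs DiaS \<phi> + occs BoxS \<phi> \<le> fm_length \<phi>"
  by (induction \<phi>) auto

lemma finite_vars: "finite (vars \<phi>)"
  by (induction \<phi>) auto

lemma fm_length_pow:
  "fm_length ((Dia ^^ k) \<phi>) = k + fm_length \<phi>" "fm_length ((Box ^^ k) \<phi>) = k + fm_length \<phi>"
  by (induction k) auto

lemma modal_depth_pow:
  "modal_depth ((Dia ^^ k) \<phi>) = k + modal_depth \<phi>"
  "modal_depth ((Box ^^ k) \<phi>) = k + modal_depth \<phi>"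
  by (induction k) auto

lemma vars_pow: "vars ((Dia ^^ k) \<phi>) = vars \<phi>" "vars ((Box ^^ k) \<phi>) = vars \<phi>"
  by (induction k) auto

lemma occs_pow:
  "occs s ((Dia ^^ k) \<phi>) = (if s = DiaS then k else 0) + occs s \<phi>"
  "occs s ((Box ^^ k) \<phi>) = (if s = BoxS then k else 0) + occs s \<phi>"
  by (induction k) auto

theorem theorem6p1:
  fixes m n p :: nat
  assumes "infinite (UNIV :: 'w set)"
    and "m \<noteq> n"
  shows "absolutely_minimal
           {\<psi>. defines_class \<psi> (transfer_frames m n :: 'w frame set)}
           (Or ((Box ^^ m) (NegVar p)) ((Dia ^^ n) (Var p)))"
proof -
  let ?\<phi> = "Or ((Box ^^ m) (NegVar p)) ((Dia ^^ n) (Var p))"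
  have "\<mu> ?\<phi> \<le> \<mu> \<psi>"
    if def: "defines_class \<psi> (transfer_frames m n :: 'w frame set)"
      and \<mu>: "\<mu> \<in> complexity_measures" for \<psi> \<mu>
  proof -
    have def1: "defines_class \<psi> (transfer_frames m n :: nat frame set)"
      and def2: "defines_class \<psi> (transfer_frames m n :: (nat \<times> nat) frame set)"
      using defines_transfer_countable[OF assms(1) def] by auto
    have vars: "card (vars \<psi>) \<ge> 1"
      using vars_nonempty[OF def1 assms(2)] finite_vars[of \<psi>] by (simp add: Suc_le_eq card_gt_0_iff)
    have disj: "occs OrS \<psi> \<ge> 1"
      using disjunction_needed[OF def1 assms(2)] by simp
    have boxes: "{..<m} \<subseteq> box_depths \<psi>"
      using box_at_every_depth[OF def1 assms(2)] .
    have box: "m \<le> occs BoxS \<psi>"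
      using card_mono[OF finite_box_depths boxes] card_box_depths[of \<psi>] by simp
    have depth_m: "m \<le> modal_depth \<psi>"
    proof (cases m)
      case (Suc k)
      then show ?thesis using boxes box_depths_less[of k \<psi>] by auto
    qed simp
    have dia: "n \<le> occs DiaS \<psi>" and depth_n: "n \<le> modal_depth \<psi>"
      using dia_depth_ge[OF def1 def2 assms(2)] dia_depth_le_occs[of \<psi>]
        dia_depth_le_modal_depth[of \<psi>] by simp_all
    consider "\<mu> = fm_length" | "\<mu> = modal_depth" | "\<mu> = (\<lambda>\<phi>. card (vars \<phi>))" | s where "\<mu> = occs s"
      using \<mu> by (auto simp: complexity_measures_def)
    then show ?thesis
    proof cases
      case 1
      then show ?thesis using fm_length_ge[of \<psi>] disj box dia by (simp add: fm_length_pow)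
    next
      case 2
      then show ?thesis using depth_m depth_n by (simp add: modal_depth_pow)
    next
      case 3
      then show ?thesis using vars by (simp add: vars_pow)
    next
      case 4
      then show ?thesis using disj box dia by (cases s) (simp_all add: occs_pow)
    qed
  qed
  then show ?thesis
    by (auto simp: absolutely_minimal_def transfer_formula_defines)
qed

end
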